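(* Let $(X,d)$ be a compact metric space, let $\mathcal{H}$ be a Hilbert space, and let $P(X)$ be the collection of all projection-valued measures from the Borel subsets $\mathcal{B}(X)$ of $X$ into the projections on $\mathcal{H}$. For $E,F\in P(X)$ define $$\rho(E,F)=\sup_{\phi\in \mathrm{Lip}_1(X)}\left\|\int\phi\,dE-\int\phi\,dF\right\|,$$ where $\|\cdot\|$ is the operator norm on $\mathcal{B}(\mathcal{H})$. Then $\rho$ is a metric on $P(X)$ (in particular it takes finite values).
   Context: $\mathcal{B}(\mathcal{H})$ denotes the bounded operators on the (complex) Hilbert space $\mathcal{H}$. A projection-valued measure $F:\mathcal{B}(X)\to\mathcal{B}(\mathcal{H})$ assigns to each Borel set an orthogonal projection, with $F(\emptyset)=0$, $F(X)=\mathrm{id}_{\mathcal{H}}$, $F(\Delta_1\cap\Delta_2)=F(\Delta_1)F(\Delta_2)$, and countable additivity (in the strong operator topology) on disjoint sequences of Borel sets. For $g,h\in\mathcal{H}$, $F_{g,h}(\Delta)=\langle F(\Delta)g,h\rangle$ is a countably additive complex measure. For a bounded Borel function $\psi:X\to\mathbb{C}$, $\int\psi\,dF$ is the unique bounded operator with $\langle(\int\psi\,dF)g,h\rangle=\int_X\psi\,dF_{g,h}$ for all $g,h\in\mathcal{H}$. $\mathrm{Lip}_1(X)=\{\phi:X\to\mathbb{R}: |\phi(x)-\phi(y)|\le d(x,y)\text{ for all }x,y\in X\}$. *)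

theory Defs
  imports "HOL-Analysis.Analysis"
begin

section \<open>Complex Hilbert spaces\<close>

text \<open>
  The class extends the library's real inner product spaces: the real inner product is the real part
  of the complex one, so norm, metric and topology are those induced by \<open>cinner\<close> (see
  \<open>cinner_self\<close> below).  The complex inner product is linear in its first argument.
\<close>

class complex_inner = real_inner +
  fixes scaleC :: "complex \<Rightarrow> 'a \<Rightarrow> 'a" (infixr "*\<^sub>C" 75)
    and cinner :: "'a \<Rightarrow> 'a \<Rightarrow> complex"
  assumes scaleC_add_right: "c *\<^sub>C (x + y) = c *\<^sub>C x + c *\<^sub>C y"
    and scaleC_add_left: "(b + c) *\<^sub>C x = b *\<^sub>C x + c *\<^sub>C x"
    and scaleC_scaleC: "b *\<^sub>C c *\<^sub>C x = (b * c) *\<^sub>C x"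
    and scaleC_of_real: "complex_of_real r *\<^sub>C x = r *\<^sub>R x"
    and cinner_commute: "cinner x y = cnj (cinner y x)"
    and cinner_add_left: "cinner (x + y) z = cinner x z + cinner y z"
    and cinner_scaleC_left: "cinner (c *\<^sub>C x) y = c * cinner x y"
    and Re_cinner: "Re (cinner x y) = inner x y"

lemma scaleC_one: "1 *\<^sub>C x = (x :: 'a::complex_inner)"
  using scaleC_of_real[of 1 x] by simp

lemma cinner_self: "cinner (x :: 'a::complex_inner) x = complex_of_real ((norm x)\<^sup>2)"
proof (rule complex_eqI)
  show "Re (cinner x x) = Re (complex_of_real ((norm x)\<^sup>2))"
    by (simp add: Re_cinner power2_norm_eq_inner)
  have "Im (cinner x x) = - Im (cinner x x)"
    using arg_cong[OF cinner_commute[of x x], of Im] by simp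
  then show "Im (cinner x x) = Im (complex_of_real ((norm x)\<^sup>2))"
    by simp
qed

lemma cinner_eq_zero_iff: "cinner (x :: 'a::complex_inner) x = 0 \<longleftrightarrow> x = 0"
  by (simp add: cinner_self)

class chilbert_space = complex_inner + complete_space

subclass (in chilbert_space) banach ..

instantiation complex :: chilbert_space
begin

definition scaleC_complex :: "complex \<Rightarrow> complex \<Rightarrow> complex"
  where "scaleC_complex c x = c * x"

definition cinner_complex :: "complex \<Rightarrow> complex \<Rightarrow> complex"
  where "cinner_complex x y = x * cnj y"

instance
  by standard
    (auto simp: scaleC_complex_def cinner_complex_def algebra_simps inner_complex_def scaleR_conv_of_real)

end


section \<open>Bounded operators and orthogonal projections\<close>

text \<open>
  \<open>'h \<Rightarrow>\<^sub>L 'h\<close> is the space of bounded real-linear operators with the operator norm; the bounded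
  operators on the complex Hilbert space are its complex-linear elements.
\<close>

definition bounded_operators :: "('h::chilbert_space \<Rightarrow>\<^sub>L 'h) set"
  where "bounded_operators = {T. \<forall>c x. blinfun_apply T (c *\<^sub>C x) = c *\<^sub>C blinfun_apply T x}"

definition orthogonal_projections :: "('h::chilbert_space \<Rightarrow>\<^sub>L 'h) set"
  where "orthogonal_projections =
    {P \<in> bounded_operators. P o\<^sub>L P = P \<and>
       (\<forall>g h. cinner (blinfun_apply P g) h = cinner g (blinfun_apply P h))}"


section \<open>Integration against complex measures\<close>

text \<open>
  A signed (complex) measure on the \<open>\<sigma>\<close>-algebra of \<open>M\<close> is a countably additive function on
  \<open>sets M\<close> with values in the reals (complex numbers); the measure carried by \<open>M\<close> itself plays no role.
  Integration is defined through the Jordan decomposition of the real and imaginary parts.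
  \<open>upper_variation M \<nu>\<close> is the positive part of \<open>\<nu>\<close>; since \<open>\<nu> {} = 0\<close>, the truncation of
  negative values by \<open>ennreal\<close> does not affect the supremum.
\<close>

definition upper_variation :: "'a measure \<Rightarrow> ('a set \<Rightarrow> real) \<Rightarrow> 'a measure"
  where "upper_variation M \<nu> =
    measure_of (space M) (sets M) (\<lambda>A. SUP B\<in>{B \<in> sets M. B \<subseteq> A}. ennreal (\<nu> B))"

definition signed_integral :: "'a measure \<Rightarrow> ('a set \<Rightarrow> real) \<Rightarrow> ('a \<Rightarrow> complex) \<Rightarrow> complex"
  where "signed_integral M \<nu> \<psi> =
    (\<integral>x. \<psi> x \<partial>upper_variation M \<nu>) - (\<integral>x. \<psi> x \<partial>upper_variation M (\<lambda>A. - \<nu> A))"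

definition complex_integral :: "'a measure \<Rightarrow> ('a set \<Rightarrow> complex) \<Rightarrow> ('a \<Rightarrow> complex) \<Rightarrow> complex"
  where "complex_integral M \<nu> \<psi> =
    signed_integral M (\<lambda>A. Re (\<nu> A)) \<psi> + \<i> * signed_integral M (\<lambda>A. Im (\<nu> A)) \<psi>"


section \<open>Projection-valued measures\<close>

text \<open>
  A projection-valued measure is a function on the Borel subsets of \<open>X\<close>.  As HOL functions are total,
  its values at other sets are fixed by extensionality, so that equality in \<open>PVM X\<close> means equality
  on all Borel subsets of \<open>X\<close>.
\<close>

abbreviation borel_on :: "'a::metric_space set \<Rightarrow> 'a measure"
  where "borel_on X \<equiv> restrict_space borel X"

definition PVM :: "'a::metric_space set \<Rightarrow> ('a set \<Rightarrow> 'h::chilbert_space \<Rightarrow>\<^sub>L 'h) set"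
  where "PVM X = {F \<in> sets (borel_on X) \<rightarrow>\<^sub>E orthogonal_projections.
    F {} = 0 \<and> F X = id_blinfun \<and>
    (\<forall>A\<in>sets (borel_on X). \<forall>B\<in>sets (borel_on X). F (A \<inter> B) = F A o\<^sub>L F B) \<and>
    (\<forall>A :: nat \<Rightarrow> 'a set. range A \<subseteq> sets (borel_on X) \<longrightarrow> disjoint_family A \<longrightarrow>
       (\<forall>g. (\<lambda>n. blinfun_apply (F (A n)) g) sums blinfun_apply (F (\<Union>n. A n)) g))}"

definition pvm_integral ::
    "'a::metric_space set \<Rightarrow> ('a set \<Rightarrow> 'h::chilbert_space \<Rightarrow>\<^sub>L 'h) \<Rightarrow> ('a \<Rightarrow> complex) \<Rightarrow> 'h \<Rightarrow>\<^sub>L 'h"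
  where "pvm_integral X F \<psi> = (THE T. T \<in> bounded_operators \<and>
    (\<forall>g h. cinner (blinfun_apply T g) h =
       complex_integral (borel_on X) (\<lambda>A. cinner (blinfun_apply (F A) g) h) \<psi>))"

text \<open>Only the values of \<open>\<phi>\<close> on \<open>X\<close> are constrained, and only these enter \<open>pvm_integral X\<close>.\<close>

definition Lip1 :: "'a::metric_space set \<Rightarrow> ('a \<Rightarrow> real) set"
  where "Lip1 X = {\<phi>. \<forall>x\<in>X. \<forall>y\<in>X. \<bar>\<phi> x - \<phi> y\<bar> \<le> dist x y}"

text \<open>The supremum is taken in \<open>[0, \<infinity>]\<close>, so that its finiteness is a genuine claim.\<close>

definition pvm_dist ::
    "'a::metric_space set \<Rightarrow> ('a set \<Rightarrow> 'h::chilbert_space \<Rightarrow>\<^sub>L 'h) \<Rightarrow> ('a set \<Rightarrow> 'h \<Rightarrow>\<^sub>L 'h) \<Rightarrow> ennreal"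
  where "pvm_dist X E F = (SUP \<phi>\<in>Lip1 X.
    ennreal (norm (pvm_integral X E (\<lambda>x. complex_of_real (\<phi> x)) -
                   pvm_integral X F (\<lambda>x. complex_of_real (\<phi> x)))))"

end

theory Submission
  imports Defs
begin

text \<open>
  A Borel function \<open>\<psi>\<close> with values in \<open>[0, 1)\<close> is the sum of \<open>2\<^sup>-\<^sup>k\<^sup>-\<^sup>1\<close> times the indicator of the set \<open>A\<^sub>k\<close>
  where the binary digit number \<open>k + 1\<close> of \<open>\<psi>\<close> is 1.  Hence \<open>\<integral>\<psi> dF\<close> is the norm convergent series
  \<open>\<Sum>k. 2\<^sup>-\<^sup>k\<^sup>-\<^sup>1 F(A\<^sub>k)\<close>, an operator of norm at most 1.  A function in \<open>Lip\<^sub>1\<close> is an affine image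
  \<open>a + b \<psi>\<close> of such a function with \<open>b\<close> controlled by the diameter of \<open>X\<close>, and the constant \<open>a\<close>
  cancels in a difference of two integrals, so the distance is finite.  If it vanishes, dominated
  convergence along multiples of the functions \<open>max 0 (1/n - infdist x C)\<close> in \<open>Lip\<^sub>1\<close> shows that
  the two projection-valued measures agree on closed sets \<open>C\<close>, hence on all Borel sets.
\<close>

section \<open>Binary digits of functions with values in the unit interval\<close>

text \<open>For \<open>\<psi> x\<close> in [0, 1) the difference of floors is the binary digit of
  weight \<open>(1/2) ^ Suc k\<close>. Written with floors, the set is visibly measurable.\<close>

definition digit_set :: "'a measure \<Rightarrow> ('a \<Rightarrow> real) \<Rightarrow> nat \<Rightarrow> 'a set"
  where "digit_set M \<psi> k = {x \<in> space M. \<lfloor>2 ^ Suc k * \<psi> x\<rfloor> - 2 * \<lfloor>2 ^ k * \<psi> x\<rfloor> = 1}"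

lemma digit_set_sets:
  assumes [measurable]: "\<psi> \<in> borel_measurable M"
  shows "digit_set M \<psi> k \<in> sets M"
  unfolding digit_set_def by measurable

lemma floor_double_diff: "\<lfloor>2 * z\<rfloor> - 2 * \<lfloor>z\<rfloor> = 0 \<or> \<lfloor>2 * z\<rfloor> - 2 * \<lfloor>z\<rfloor> = 1" for z :: real
  by linarith

lemma binary_digits_sums:
  fixes y :: real
  assumes "0 \<le> y" "y < 1"
  shows "(\<lambda>k. (1/2) ^ Suc k * of_bool (\<lfloor>2 ^ Suc k * y\<rfloor> - 2 * \<lfloor>2 ^ k * y\<rfloor> = 1)) sums y"
proof -
  let ?d = "\<lambda>k. (1/2) ^ Suc k * of_bool (\<lfloor>2 ^ Suc k * y\<rfloor> - 2 * \<lfloor>2 ^ k * y\<rfloor> = 1) :: real"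
  \<comment> \<open>The partial sums telescope: the first n digits spell y truncated to a multiple
    of \<open>1 / 2 ^ n\<close>.\<close>
  have "(\<Sum>k<n. ?d k) = of_int \<lfloor>2 ^ n * y\<rfloor> / 2 ^ n" for n
  proof (induction n)
    case 0
    have "\<lfloor>y\<rfloor> = 0"
      using assms by linarith
    then show ?case by simp
  next
    case (Suc n)
    have *: "of_bool (\<lfloor>2 ^ Suc n * y\<rfloor> - 2 * \<lfloor>2 ^ n * y\<rfloor> = 1)
        = (of_int (\<lfloor>2 ^ Suc n * y\<rfloor> - 2 * \<lfloor>2 ^ n * y\<rfloor>) :: real)"
      using floor_double_diff[of "2 ^ n * y"] by (auto simp: mult.assoc)
    show ?case
      unfolding sum.lessThan_Suc Suc.IH * by (simp add: field_simps)
  qed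
  moreover have "(\<lambda>n. of_int \<lfloor>2 ^ n * y\<rfloor> / 2 ^ n) \<longlonglongrightarrow> y"
  proof (rule Lim_null_comparison[where g = "\<lambda>n. (1/2) ^ n", THEN LIM_zero_cancel])
    have "\<bar>of_int \<lfloor>2 ^ n * y\<rfloor> / 2 ^ n - y\<bar> \<le> (1/2) ^ n" for n
    proof -
      have "of_int \<lfloor>2 ^ n * y\<rfloor> / 2 ^ n - y = (of_int \<lfloor>2 ^ n * y\<rfloor> - 2 ^ n * y) / 2 ^ n"
        by (simp add: field_simps)
      moreover have "\<bar>of_int \<lfloor>2 ^ n * y\<rfloor> - 2 ^ n * y\<bar> \<le> 1"
        by linarith
      ultimately show ?thesis
        by (simp add: power_one_over divide_right_mono)
    qed
    then show "\<forall>\<^sub>F n in sequentially. norm (of_int \<lfloor>2 ^ n * y\<rfloor> / 2 ^ n - y) \<le> (1/2) ^ n"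
      by simp
    show "(\<lambda>n. (1/2) ^ n) \<longlonglongrightarrow> (0::real)"
      by (simp add: LIMSEQ_power_zero)
  qed
  ultimately show ?thesis
    by (simp add: sums_def)
qed

lemma digit_set_sums:
  assumes "x \<in> space M" "0 \<le> \<psi> x" "\<psi> x < 1"
  shows "(\<lambda>k. (1/2) ^ Suc k * indicator (digit_set M \<psi> k) x) sums \<psi> x"
  using binary_digits_sums[OF assms(2,3)] assms(1)
  by (simp add: digit_set_def indicator_def of_bool_def)

lemma half_powers_sums: "(\<lambda>k. (1/2 :: real) ^ Suc k) sums 1"
  using power_half_series by simp

text \<open>The digit expansion may be integrated term by term, because the norms of its terms have
  integrals dominated by a geometric series times the finite total mass.\<close>

lemma (in finite_measure) integral_digit_set_sums:
  assumes [measurable]: "\<psi> \<in> borel_measurable M"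
    and range: "\<And>x. x \<in> space M \<Longrightarrow> 0 \<le> \<psi> x \<and> \<psi> x < 1"
  shows "(\<lambda>k. (1/2) ^ Suc k * measure M (digit_set M \<psi> k)) sums (\<integral>x. \<psi> x \<partial>M)"
proof -
  let ?f = "\<lambda>k x. (1/2) ^ Suc k * indicator (digit_set M \<psi> k) x :: real"
  have int: "(\<integral>x. ?f k x \<partial>M) = (1/2) ^ Suc k * measure M (digit_set M \<psi> k)" for k
    using sets.sets_into_space[OF digit_set_sets[OF assms(1)]] by (simp add: Int_absorb2)
  have "(\<lambda>k. \<integral>x. ?f k x \<partial>M) sums (\<integral>x. (\<Sum>k. ?f k x) \<partial>M)"
  proof (rule sums_integral)
    show "integrable M (?f k)" for k
      by (intro integrable_mult_right integrable_real_indicator digit_set_sets) 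
         (auto simp: less_top[symmetric])
    show "AE x in M. summable (\<lambda>k. norm (?f k x))"
    proof (rule AE_I2)
      fix x assume "x \<in> space M"
      then have "summable (\<lambda>k. ?f k x)"
        by (intro sums_summable[OF digit_set_sums]) (simp_all add: range)
      moreover have "norm (?f k x) = ?f k x" for k
        by simp
      ultimately show "summable (\<lambda>k. norm (?f k x))"
        by presburger
    qed
    have bound: "norm (\<integral>x. norm (?f k x) \<partial>M) \<le> (1/2) ^ Suc k * measure M (space M)" for k
    proof -
      have "(\<integral>x. norm (?f k x) \<partial>M) = (1/2) ^ Suc k * measure M (digit_set M \<psi> k)"
        using int[of k] by (simp add: abs_mult)
      then show ?thesis
        by (simp add: bounded_measure)
    qed
    have "summable (\<lambda>k. (1/2) ^ Suc k * measure M (space M))"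
      by (rule summable_mult2[OF sums_summable[OF half_powers_sums]])
    then show "summable (\<lambda>k. \<integral>x. norm (?f k x) \<partial>M)"
      using bound by (rule summable_comparison_test')
  qed
  moreover have "(\<integral>x. (\<Sum>k. ?f k x) \<partial>M) = (\<integral>x. \<psi> x \<partial>M)"
    by (intro Bochner_Integration.integral_cong refl sums_unique[OF digit_set_sums, symmetric])
       (simp_all add: range)
  ultimately show ?thesis
    by (simp only: int)
qed


section \<open>Bounded signed measures\<close>

lemma signed_integral_of_real:
  "signed_integral M \<nu> (\<lambda>x. complex_of_real (\<phi> x)) = complex_of_real
    ((\<integral>x. \<phi> x \<partial>upper_variation M \<nu>) - (\<integral>x. \<phi> x \<partial>upper_variation M (\<lambda>A. - \<nu> A)))"
  by (simp add: signed_integral_def)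

text \<open>The explicit bound makes both Jordan parts finite measures. In the application it comes
  from the Cauchy-Schwarz inequality.\<close>

locale bounded_signed_measure =
  fixes M :: "'a measure" and \<nu> :: "'a set \<Rightarrow> real" and K :: real
  assumes sums_UN: "range A \<subseteq> sets M \<Longrightarrow> disjoint_family A \<Longrightarrow>
      (\<lambda>n::nat. \<nu> (A n)) sums \<nu> (\<Union>n. A n)"
    and bounded: "B \<in> sets M \<Longrightarrow> \<bar>\<nu> B\<bar> \<le> K"
begin

text \<open>The negative part of \<nu> is the positive part of its negation, so facts about the one
  transfer to the other.\<close>

lemma uminus: "bounded_signed_measure M (\<lambda>A. - \<nu> A) K"
  by unfold_locales (auto intro: sums_minus sums_UN bounded)

text \<open>Countably many copies of the empty set give a convergent series with constant terms, so
  the term is 0.\<close>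

lemma empty [simp]: "\<nu> {} = 0"
  using sums_UN[of "\<lambda>_. {}"] by (auto simp: disjoint_family_on_def summable_const_iff dest!: sums_summable)

lemma Un_disjoint:
  assumes "A \<in> sets M" "B \<in> sets M" "A \<inter> B = {}"
  shows "\<nu> (A \<union> B) = \<nu> A + \<nu> B"
proof -
  have "disjoint_family (binaryset A B)"
    using assms(3) by (auto simp: disjoint_family_on_def binaryset_def)
  then have "(\<lambda>n. \<nu> (binaryset A B n)) sums \<nu> (A \<union> B)"
    using sums_UN[of "binaryset A B"] assms by (simp add: range_binaryset_eq UN_binaryset_eq)
  then show ?thesis
    using binaryset_sums[of \<nu> A B] sums_unique2 by auto
qed

lemma Diff:
  assumes "A \<in> sets M" "B \<in> sets M" "B \<subseteq> A"
  shows "\<nu> (A - B) = \<nu> A - \<nu> B"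
proof -
  have "A - B \<union> B = A" "(A - B) \<inter> B = {}"
    using assms(3) by auto
  then show ?thesis
    using Un_disjoint[of "A - B" B] assms(1,2) by simp
qed

section \<open>The upper variation as a finite measure\<close>

definition sup_below :: "'a set \<Rightarrow> ennreal"
  where "sup_below A = (SUP B\<in>{B \<in> sets M. B \<subseteq> A}. ennreal (\<nu> B))"

lemma sup_belowI: "B \<in> sets M \<Longrightarrow> B \<subseteq> A \<Longrightarrow> ennreal (\<nu> B) \<le> sup_below A"
  unfolding sup_below_def by (auto intro: SUP_upper)

lemma sup_below_leI:
  "(\<And>B. B \<in> sets M \<Longrightarrow> B \<subseteq> A \<Longrightarrow> ennreal (\<nu> B) \<le> u) \<Longrightarrow> sup_below A \<le> u"
  unfolding sup_below_def by (auto intro: SUP_least)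

lemma sup_below_mono: "A \<subseteq> B \<Longrightarrow> sup_below A \<le> sup_below B"
  by (auto intro!: sup_below_leI sup_belowI)

lemma sup_below_superadditive:
  assumes "A \<inter> B = {}"
  shows "sup_below A + sup_below B \<le> sup_below (A \<union> B)"
proof -
  have "ennreal (\<nu> C) + ennreal (\<nu> D) \<le> sup_below (A \<union> B)"
    if "C \<in> sets M" "C \<subseteq> A" "D \<in> sets M" "D \<subseteq> B" for C D
  proof -
    \<comment> \<open>\<open>ennreal\<close> truncates negative values to 0. If one value is at most
      0, the other set alone is a competitor; otherwise the union is.\<close>
    consider "\<nu> C \<le> 0" | "\<nu> D \<le> 0" | "0 \<le> \<nu> C" "0 \<le> \<nu> D"
      by linarith
    then show ?thesis
    proof cases
      case 1
      then show ?thesis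
        using that sup_belowI[of D "A \<union> B"] by (auto simp: ennreal_neg)
    next
      case 2
      then show ?thesis
        using that sup_belowI[of C "A \<union> B"] by (auto simp: ennreal_neg)
    next
      case 3
      have "C \<inter> D = {}"
        using that assms by auto
      then have "ennreal (\<nu> C) + ennreal (\<nu> D) = ennreal (\<nu> (C \<union> D))"
        using 3 that by (simp add: Un_disjoint)
      then show ?thesis
        using that sup_belowI[of "C \<union> D" "A \<union> B"] by auto
    qed
  qed
  \<comment> \<open>Nonemptiness, witnessed by the empty set, allows both suprema to be moved out of
    the sum.\<close>
  moreover have "{B \<in> sets M. B \<subseteq> A} \<noteq> {}" for A
    by auto
  ultimately show ?thesis
    unfolding sup_below_def[of A] sup_below_def[of B]
    by (subst ennreal_SUP_add_left[symmetric], blast, subst ennreal_SUP_add_right, blast)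
       (intro SUP_least, blast)
qed

text \<open>Superadditivity over finite unions bounds the partial sums. Conversely, a competitor B
  for the union is cut into the pieces \<open>B \<inter> A i\<close>, each a competitor for
  \<open>A i\<close>, and \<nu> is countably additive along them.\<close>

lemma sup_below_countably_additive: "countably_additive (sets M) sup_below"
proof (rule countably_additiveI)
  fix A :: "nat \<Rightarrow> 'a set"
  assume A: "range A \<subseteq> sets M" "disjoint_family A"
  show "(\<Sum>i. sup_below (A i)) = sup_below (\<Union>i. A i)"
  proof (rule antisym)
    have "(\<Sum>i<n. sup_below (A i)) \<le> sup_below (\<Union>i<n. A i)" for n
    proof (induction n)
      case (Suc n)
      have "A i \<inter> A n = {}" if "i < n" for i
        using disjoint_family_onD[OF A(2), of i n] that by simp
      then have "(\<Union>i<n. A i) \<inter> A n = {}"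
        by blast
      then have "sup_below (\<Union>i<n. A i) + sup_below (A n) \<le> sup_below ((\<Union>i<n. A i) \<union> A n)"
        by (rule sup_below_superadditive)
      moreover have "(\<Union>i<n. A i) \<union> A n = (\<Union>i<Suc n. A i)"
        by (auto simp: less_Suc_eq)
      ultimately show ?case
        using order_trans[OF add_right_mono[OF Suc.IH, of "sup_below (A n)"]]
        unfolding sum.lessThan_Suc by metis
    qed simp
    also have "sup_below (\<Union>i<n. A i) \<le> sup_below (\<Union>i. A i)" for n
      by (rule sup_below_mono) auto
    finally show "(\<Sum>i. sup_below (A i)) \<le> sup_below (\<Union>i. A i)"
      by (rule suminf_le_const[OF summableI])
  next
    show "sup_below (\<Union>i. A i) \<le> (\<Sum>i. sup_below (A i))"
    proof (rule sup_below_leI)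
      fix B assume B: "B \<in> sets M" "B \<subseteq> (\<Union>i. A i)"
      have "(\<lambda>i. \<nu> (B \<inter> A i)) sums \<nu> (\<Union>i. B \<inter> A i)"
        using A B by (intro sums_UN) (auto simp: disjoint_family_on_def)
      moreover have "(\<Union>i. B \<inter> A i) = B"
        using B by auto
      ultimately have "(\<lambda>n. ennreal (\<Sum>i<n. \<nu> (B \<inter> A i))) \<longlonglongrightarrow> ennreal (\<nu> B)"
        by (auto simp: sums_def intro: tendsto_ennrealI)
      moreover have "ennreal (\<Sum>i<n. \<nu> (B \<inter> A i)) \<le> (\<Sum>i. sup_below (A i))" for n
      proof -
        \<comment> \<open>The summands are made nonnegative first, since only then does
          \<open>ennreal\<close> distribute over the sum.\<close>
        have "ennreal (\<Sum>i<n. \<nu> (B \<inter> A i)) \<le> ennreal (\<Sum>i<n. max 0 (\<nu> (B \<inter> A i)))"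
          by (intro ennreal_leI sum_mono) simp
        also have "\<dots> = (\<Sum>i<n. ennreal (max 0 (\<nu> (B \<inter> A i))))"
          by simp
        also have "\<dots> \<le> (\<Sum>i<n. sup_below (A i))"
          using A B by (intro sum_mono) (auto simp: max_def ennreal_0 intro: sup_belowI)
        also have "\<dots> \<le> (\<Sum>i. sup_below (A i))"
          by (rule sum_le_suminf) auto
        finally show ?thesis .
      qed
      ultimately show "ennreal (\<nu> B) \<le> (\<Sum>i. sup_below (A i))"
        by (intro LIMSEQ_le_const2[of _ "ennreal (\<nu> B)"]) auto
    qed
  qed
qed

lemma space_upper_variation [simp]: "space (upper_variation M \<nu>) = space M"
  and sets_upper_variation [simp, measurable_cong]: "sets (upper_variation M \<nu>) = sets M"
  by (simp_all only: upper_variation_def space_measure_of sets_measure_of sets.space_closed sets.sigma_sets_eq)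

lemma emeasure_upper_variation:
  assumes "A \<in> sets M"
  shows "emeasure (upper_variation M \<nu>) A = sup_below A"
proof -
  have "positive (sets M) sup_below"
    unfolding positive_def sup_below_def by (simp cong: conj_cong)
  then show ?thesis
    unfolding upper_variation_def sup_below_def[symmetric]
    using sup_below_countably_additive assms
    by (intro emeasure_measure_of_sigma sets.sigma_algebra_axioms)
qed

lemma sup_below_le_bound: "A \<in> sets M \<Longrightarrow> sup_below A \<le> ennreal K"
  using bounded by (auto intro!: sup_below_leI ennreal_leI simp: abs_le_iff)

lemma finite_upper_variation: "finite_measure (upper_variation M \<nu>)"
  using sup_below_le_bound[of "space M"]
  by (intro finite_measureI) (auto simp: emeasure_upper_variation top_unique)

interpretation pos_part: finite_measure "upper_variation M \<nu>"
  by (rule finite_upper_variation)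

section \<open>The Jordan decomposition\<close>

lemma le_measure_upper_variation:
  assumes "A \<in> sets M" "B \<in> sets M" "B \<subseteq> A"
  shows "\<nu> B \<le> measure (upper_variation M \<nu>) A"
proof -
  have "ennreal (\<nu> B) \<le> ennreal (measure (upper_variation M \<nu>) A)"
    using sup_belowI[OF assms(2,3)] assms
    by (simp add: emeasure_upper_variation[symmetric] pos_part.emeasure_eq_measure)
  then show ?thesis
    by (simp add: ennreal_le_iff)
qed

lemma measure_upper_variation_le:
  assumes A: "A \<in> sets M"
    and *: "\<And>B. B \<in> sets M \<Longrightarrow> B \<subseteq> A \<Longrightarrow> \<nu> B \<le> u"
  shows "measure (upper_variation M \<nu>) A \<le> u"
proof -
  have "0 \<le> u"
    using *[of "{}"] by simp
  moreover have "sup_below A \<le> ennreal u"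
    using * by (auto intro!: sup_below_leI ennreal_leI)
  ultimately show ?thesis
    using A by (simp add: emeasure_upper_variation[symmetric] pos_part.emeasure_eq_measure ennreal_le_iff)
qed

interpretation neg: bounded_signed_measure M "\<lambda>A. - \<nu> A" K
  by (rule uminus)

interpretation neg_part: finite_measure "upper_variation M (\<lambda>A. - \<nu> A)"
  by (rule neg.finite_upper_variation)

text \<open>For B inside A, \<open>\<nu> B = \<nu> A - \<nu> (A - B)\<close> is at most
  \<open>\<nu> A\<close> plus the negative part of A. The supremum over B gives one inequality, and
  the same argument for the negated measure gives the other.\<close>

lemma jordan_decomposition:
  assumes A: "A \<in> sets M"
  shows "\<nu> A = measure (upper_variation M \<nu>) A - measure (upper_variation M (\<lambda>A. - \<nu> A)) A"
proof -
  have "measure (upper_variation M \<nu>) A \<le> \<nu> A + measure (upper_variation M (\<lambda>A. - \<nu> A)) A"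
  proof (rule measure_upper_variation_le[OF A])
    fix B assume "B \<in> sets M" "B \<subseteq> A"
    then show "\<nu> B \<le> \<nu> A + measure (upper_variation M (\<lambda>A. - \<nu> A)) A"
      using neg.le_measure_upper_variation[of A "A - B"] A by (auto simp: Diff)
  qed
  moreover have "measure (upper_variation M (\<lambda>A. - \<nu> A)) A \<le> measure (upper_variation M \<nu>) A - \<nu> A"
  proof (rule neg.measure_upper_variation_le[OF A])
    fix B assume "B \<in> sets M" "B \<subseteq> A"
    then show "- \<nu> B \<le> measure (upper_variation M \<nu>) A - \<nu> A"
      using le_measure_upper_variation[of A "A - B"] A by (auto simp: Diff)
  qed
  ultimately show ?thesis
    by simp
qed

section \<open>Integrals against signed measures\<close>

text \<open>Subtracting the digit expansions for the two Jordan parts expresses the integral through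
  values of \<nu> alone. The sum S is left open so that it can be identified with an inner product
  later.\<close>

lemma signed_integral_affine_sums:
  assumes [measurable]: "\<psi> \<in> borel_measurable M"
    and range: "\<And>x. x \<in> space M \<Longrightarrow> 0 \<le> \<psi> x \<and> \<psi> x < 1"
    and \<phi>: "\<And>x. x \<in> space M \<Longrightarrow> \<phi> x = a + b * \<psi> x"
    and S: "(\<lambda>k. (1/2) ^ Suc k * \<nu> (digit_set M \<psi> k)) sums S"
  shows "signed_integral M \<nu> (\<lambda>x. complex_of_real (\<phi> x)) = complex_of_real (a * \<nu> (space M) + b * S)"
proof -
  let ?P = "upper_variation M \<nu>" and ?N = "upper_variation M (\<lambda>A. - \<nu> A)"
  have eq: "digit_set ?P \<psi> = digit_set M \<psi>" "digit_set ?N \<psi> = digit_set M \<psi>"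
    by (simp_all add: digit_set_def fun_eq_iff)
  have "(\<lambda>k. (1/2) ^ Suc k * measure ?P (digit_set M \<psi> k) -
          (1/2) ^ Suc k * measure ?N (digit_set M \<psi> k)) sums ((\<integral>x. \<psi> x \<partial>?P) - (\<integral>x. \<psi> x \<partial>?N))"
    using pos_part.integral_digit_set_sums[of \<psi>] neg_part.integral_digit_set_sums[of \<psi>] range
    unfolding eq by (intro sums_diff) auto
  then have "(\<lambda>k. (1/2) ^ Suc k * \<nu> (digit_set M \<psi> k)) sums ((\<integral>x. \<psi> x \<partial>?P) - (\<integral>x. \<psi> x \<partial>?N))"
    by (simp add: jordan_decomposition digit_set_sets right_diff_distrib)
  with S have S_eq: "S = (\<integral>x. \<psi> x \<partial>?P) - (\<integral>x. \<psi> x \<partial>?N)"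
    by (rule sums_unique2)
  have "integrable ?P \<psi>" "integrable ?N \<psi>"
    using range
    by (auto intro!: pos_part.integrable_const_bound[of _ 1] neg_part.integrable_const_bound[of _ 1] AE_I2
        simp: less_imp_le)
  have affine: "(\<integral>x. \<phi> x \<partial>Q) = a * measure Q (space M) + b * (\<integral>x. \<psi> x \<partial>Q)"
    if "finite_measure Q" "space Q = space M" "integrable Q \<psi>" for Q
  proof -
    interpret Q: finite_measure Q
      by fact
    have "(\<integral>x. \<phi> x \<partial>Q) = (\<integral>x. a + b * \<psi> x \<partial>Q)"
      using \<phi> that(2) by (intro Bochner_Integration.integral_cong) auto
    then show ?thesis
      using that by simp
  qed
  have "(\<integral>x. \<phi> x \<partial>?P) = a * measure ?P (space M) + b * (\<integral>x. \<psi> x \<partial>?P)"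
    by (intro affine pos_part.finite_measure_axioms space_upper_variation) fact
  moreover have "(\<integral>x. \<phi> x \<partial>?N) = a * measure ?N (space M) + b * (\<integral>x. \<psi> x \<partial>?N)"
    by (intro affine neg_part.finite_measure_axioms neg.space_upper_variation) fact
  ultimately show ?thesis
    by (simp only: signed_integral_of_real S_eq jordan_decomposition[OF sets.top]) (simp add: algebra_simps)
qed

text \<open>Dominated convergence on each Jordan part; the constant B is integrable because both
  parts are finite.\<close>

lemma signed_integral_tendsto_indicator:
  assumes [measurable]: "\<And>n. \<phi> n \<in> borel_measurable M" "A \<in> sets M"
    and bound: "\<And>n x. \<bar>\<phi> n x\<bar> \<le> B"
    and lim: "\<And>x. x \<in> space M \<Longrightarrow> (\<lambda>n. \<phi> n x) \<longlonglongrightarrow> indicator A x"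
  shows "(\<lambda>n. signed_integral M \<nu> (\<lambda>x. complex_of_real (\<phi> n x))) \<longlonglongrightarrow> complex_of_real (\<nu> A)"
proof -
  let ?P = "upper_variation M \<nu>" and ?N = "upper_variation M (\<lambda>A. - \<nu> A)"
  have "(\<lambda>n. \<integral>x. \<phi> n x \<partial>?P) \<longlonglongrightarrow> (\<integral>x. indicator A x \<partial>?P)"
    using bound lim by (intro integral_dominated_convergence[where w = "\<lambda>_. B"]) auto
  moreover have "(\<lambda>n. \<integral>x. \<phi> n x \<partial>?N) \<longlonglongrightarrow> (\<integral>x. indicator A x \<partial>?N)"
    using bound lim by (intro integral_dominated_convergence[where w = "\<lambda>_. B"]) auto
  ultimately show ?thesis
    using sets.sets_into_space[OF assms(2)]
    unfolding signed_integral_of_real jordan_decomposition[OF assms(2)]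
    by (intro tendsto_of_real tendsto_diff) (simp_all add: Int_absorb2)
qed

end


section \<open>Operators on complex Hilbert spaces\<close>

text \<open>Imaginary parts become real inner products with a rotated second vector, so real signed
  measures suffice for the complex integral.\<close>

lemma Im_cinner: "Im (cinner x y) = inner x (\<i> *\<^sub>C y)" for x y :: "'a::complex_inner"
proof -
  have "cinner x (\<i> *\<^sub>C y) = - \<i> * cinner x y"
    using cinner_commute[of x "\<i> *\<^sub>C y"] cinner_commute[of x y] by (simp add: cinner_scaleC_left)
  then show ?thesis
    by (simp flip: Re_cinner)
qed

lemma norm_scaleC: "norm (c *\<^sub>C x) = cmod c * norm x" for x :: "'a::complex_inner"
proof -
  have "cinner x (c *\<^sub>C x) = cnj c * cinner x x"
    using cinner_commute[of x "c *\<^sub>C x"] cinner_commute[of x x] by (simp add: cinner_scaleC_left)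
  then have "cinner (c *\<^sub>C x) (c *\<^sub>C x) = (c * cnj c) * cinner x x"
    by (simp add: cinner_scaleC_left)
  then have "complex_of_real ((norm (c *\<^sub>C x))\<^sup>2) = complex_of_real ((cmod c * norm x)\<^sup>2)"
    unfolding cinner_self complex_norm_square[symmetric] by (simp add: power_mult_distrib)
  then have "(norm (c *\<^sub>C x))\<^sup>2 = (cmod c * norm x)\<^sup>2"
    using of_real_eq_iff by blast
  then show ?thesis
    by (rule power2_eq_imp_eq) auto
qed

lemma bounded_linear_scaleC: "bounded_linear (\<lambda>x. c *\<^sub>C (x :: 'a::complex_inner))"
proof (rule bounded_linear_intro)
  show "c *\<^sub>C (x + y) = c *\<^sub>C x + c *\<^sub>C y" for x y :: 'a
    by (rule scaleC_add_right)
  show "c *\<^sub>C (r *\<^sub>R x) = r *\<^sub>R (c *\<^sub>C x)" for r and x :: 'a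
    by (simp add: scaleC_scaleC mult.commute flip: scaleC_of_real)
  show "norm (c *\<^sub>C x) \<le> norm x * cmod c" for x :: 'a
    by (simp add: norm_scaleC)
qed

lemma blinfun_eq_innerI:
  assumes "\<And>g h. inner (blinfun_apply S g) h = inner (blinfun_apply T g) h"
  shows "S = T"
  by (intro blinfun_eqI) (metis assms inner_commute vector_eq_ldot)

lemma bounded_linear_inner_apply: "bounded_linear (\<lambda>T. inner (blinfun_apply T g) h)"
  by (intro bounded_linear_compose[OF bounded_linear_inner_left] blinfun.bounded_linear_left)

lemma bounded_operators_id: "id_blinfun \<in> bounded_operators"
  by (simp add: bounded_operators_def)

lemma bounded_operators_add:
  "S \<in> bounded_operators \<Longrightarrow> T \<in> bounded_operators \<Longrightarrow> S + T \<in> bounded_operators"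
  by (simp add: bounded_operators_def blinfun.add_left scaleC_add_right)

lemma bounded_operators_scaleR: "T \<in> bounded_operators \<Longrightarrow> r *\<^sub>R T \<in> bounded_operators"
  by (simp add: bounded_operators_def blinfun.scaleR_left scaleC_scaleC mult.commute flip: scaleC_of_real)

text \<open>Complex linearity survives the limit because multiplication by a complex scalar is
  continuous.\<close>

lemma bounded_operators_sums:
  assumes T: "\<And>n. T n \<in> bounded_operators" and S: "T sums S"
  shows "S \<in> bounded_operators"
proof -
  have app: "(\<lambda>n. blinfun_apply (T n) x) sums blinfun_apply S x" for x
    using bounded_linear.sums[OF blinfun.bounded_linear_left S] .
  have "blinfun_apply S (c *\<^sub>C x) = c *\<^sub>C blinfun_apply S x" for c x
  proof -
    have "(\<lambda>n. blinfun_apply (T n) (c *\<^sub>C x)) = (\<lambda>n. c *\<^sub>C blinfun_apply (T n) x)"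
      using T by (simp add: bounded_operators_def)
    then show ?thesis
      using app[of "c *\<^sub>C x"] bounded_linear.sums[OF bounded_linear_scaleC app[of x], of c]
      by (metis sums_unique2)
  qed
  then show ?thesis
    by (simp add: bounded_operators_def)
qed

text \<open>Idempotence and self-adjointness turn the squared norm of \<open>P g\<close> into the
  inner product of g with \<open>P g\<close>; Cauchy-Schwarz then permits dividing by the norm of
  \<open>P g\<close>.\<close>

lemma norm_orthogonal_projection_apply_le:
  assumes "P \<in> orthogonal_projections"
  shows "norm (blinfun_apply P g) \<le> norm g"
proof -
  have "blinfun_apply P (blinfun_apply P g) = blinfun_apply P g"
    using assms by (auto simp: orthogonal_projections_def dest: arg_cong[where f = "\<lambda>T. blinfun_apply T g"])
  then have "cinner (blinfun_apply P g) (blinfun_apply P g) = cinner g (blinfun_apply P g)"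
    using assms by (auto simp: orthogonal_projections_def)
  then have "norm (blinfun_apply P g) * norm (blinfun_apply P g) = inner g (blinfun_apply P g)"
    by (metis Re_cinner power2_norm_eq_inner power2_eq_square)
  also have "\<dots> \<le> norm g * norm (blinfun_apply P g)"
    by (rule norm_cauchy_schwarz)
  finally show ?thesis
    by (cases "blinfun_apply P g = 0") auto
qed

lemma norm_orthogonal_projection_le:
  "P \<in> orthogonal_projections \<Longrightarrow> norm P \<le> 1"
  by (intro norm_blinfun_bound) (auto simp: norm_orthogonal_projection_apply_le)


section \<open>Integration against projection-valued measures\<close>

lemma space_borel_on: "space (borel_on X) = X"
  by (simp add: space_restrict_space)

lemma PVM_projection: "F \<in> PVM X \<Longrightarrow> A \<in> sets (borel_on X) \<Longrightarrow> F A \<in> orthogonal_projections"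
  by (auto simp: PVM_def)

lemma PVM_sums:
  "F \<in> PVM X \<Longrightarrow> range A \<subseteq> sets (borel_on X) \<Longrightarrow> disjoint_family A \<Longrightarrow>
    (\<lambda>n::nat. blinfun_apply (F (A n)) g) sums blinfun_apply (F (\<Union>n. A n)) g"
  unfolding PVM_def by blast

text \<open>Strong countable additivity passes through the continuous inner product, and the bound
  holds since projections are contractions.\<close>

lemma PVM_bounded_signed_measure:
  assumes F: "F \<in> PVM X"
  shows "bounded_signed_measure (borel_on X) (\<lambda>A. inner (blinfun_apply (F A) g) h) (norm g * norm h)"
proof
  show "(\<lambda>n. inner (blinfun_apply (F (A n)) g) h) sums inner (blinfun_apply (F (\<Union>n. A n)) g) h"
    if "range A \<subseteq> sets (borel_on X)" "disjoint_family A" for A :: "nat \<Rightarrow> _ set"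
    using bounded_linear.sums[OF bounded_linear_inner_left PVM_sums[OF F that]] .
  show "\<bar>inner (blinfun_apply (F A) g) h\<bar> \<le> norm g * norm h" if "A \<in> sets (borel_on X)" for A
    using Cauchy_Schwarz_ineq2[of "blinfun_apply (F A) g" h]
      mult_right_mono[OF norm_orthogonal_projection_apply_le[OF PVM_projection[OF F that]], of "norm h" g]
    by simp
qed

text \<open>For \<psi> with values in [0, 1) on X this is the integral of \<psi>: the digit
  expansion with indicators replaced by projections.\<close>

definition digit_operator ::
    "'a::metric_space set \<Rightarrow> ('a set \<Rightarrow> 'h::chilbert_space \<Rightarrow>\<^sub>L 'h) \<Rightarrow> ('a \<Rightarrow> real) \<Rightarrow> 'h \<Rightarrow>\<^sub>L 'h"
  where "digit_operator X F \<psi> = (\<Sum>k. (1/2) ^ Suc k *\<^sub>R F (digit_set (borel_on X) \<psi> k))"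

context
  fixes X :: "'a::metric_space set" and F :: "'a set \<Rightarrow> 'h::chilbert_space \<Rightarrow>\<^sub>L 'h" and \<psi> :: "'a \<Rightarrow> real"
  assumes F: "F \<in> PVM X" and \<psi>: "\<psi> \<in> borel_measurable (borel_on X)"
begin

lemma norm_digit_term_le: "norm ((1/2) ^ Suc k *\<^sub>R F (digit_set (borel_on X) \<psi> k)) \<le> (1/2) ^ Suc k"
  using norm_orthogonal_projection_le[OF PVM_projection[OF F digit_set_sets[OF \<psi>]], of k]
  by (simp add: divide_right_mono)

lemma digit_operator_sums:
  "(\<lambda>k. (1/2) ^ Suc k *\<^sub>R F (digit_set (borel_on X) \<psi> k)) sums digit_operator X F \<psi>"
  unfolding digit_operator_def
  by (rule summable_sums, rule summable_comparison_test'[OF sums_summable[OF half_powers_sums]],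
      rule norm_digit_term_le)

lemma norm_digit_operator_le: "norm (digit_operator X F \<psi>) \<le> 1"
  using norm_suminf_le[OF norm_digit_term_le sums_summable[OF half_powers_sums]]
  by (simp only: digit_operator_def sums_unique[OF half_powers_sums, symmetric])

lemma digit_operator_bounded_operators: "digit_operator X F \<psi> \<in> bounded_operators"
proof (rule bounded_operators_sums[OF _ digit_operator_sums])
  show "(1/2) ^ Suc k *\<^sub>R F (digit_set (borel_on X) \<psi> k) \<in> bounded_operators" for k
    using PVM_projection[OF F digit_set_sets[OF \<psi>], of k]
    by (intro bounded_operators_scaleR) (simp add: orthogonal_projections_def)
qed

context
  fixes \<phi> :: "'a \<Rightarrow> real" and a b :: real
  assumes range: "\<And>x. x \<in> X \<Longrightarrow> 0 \<le> \<psi> x \<and> \<psi> x < 1"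
    and \<phi>: "\<And>x. x \<in> X \<Longrightarrow> \<phi> x = a + b * \<psi> x"
begin

text \<open>Pairing the norm convergent operator series with g and h gives the scalar digit series.
  The constant a is multiplied by the total mass, which is the inner product of g and h because
  \<open>F X\<close> is the identity.\<close>

lemma signed_integral_eq_inner:
  "signed_integral (borel_on X) (\<lambda>A. inner (blinfun_apply (F A) g) h) (\<lambda>x. complex_of_real (\<phi> x)) =
    complex_of_real (inner (blinfun_apply (a *\<^sub>R id_blinfun + b *\<^sub>R digit_operator X F \<psi>) g) h)"
proof -
  interpret bounded_signed_measure "borel_on X" "\<lambda>A. inner (blinfun_apply (F A) g) h" "norm g * norm h"
    by (rule PVM_bounded_signed_measure[OF F])
  have "(\<lambda>k. (1/2) ^ Suc k * inner (blinfun_apply (F (digit_set (borel_on X) \<psi> k)) g) h)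
      sums inner (blinfun_apply (digit_operator X F \<psi>) g) h"
    using bounded_linear.sums[OF bounded_linear_inner_apply digit_operator_sums, of g h]
    by (simp add: blinfun.scaleR_left)
  from signed_integral_affine_sums[OF \<psi> _ _ this, of \<phi> a b] show ?thesis
    using F range \<phi>
    by (simp add: space_borel_on PVM_def blinfun.add_left blinfun.scaleR_left inner_add_left)
qed

text \<open>The explicit operator is a witness for the definite description, and it is the only one
  since inner products determine an operator.\<close>

lemma pvm_integral_eq:
  "pvm_integral X F (\<lambda>x. complex_of_real (\<phi> x)) = a *\<^sub>R id_blinfun + b *\<^sub>R digit_operator X F \<psi>"
  (is "_ = ?T")
  unfolding pvm_integral_def
proof (rule the_equality)
  \<comment> \<open>The imaginary part is the real identity with \<open>\<i> *\<^sub>C h\<close> in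
    place of h.\<close>
  have T: "complex_integral (borel_on X) (\<lambda>A. cinner (blinfun_apply (F A) g) h) (\<lambda>x. complex_of_real (\<phi> x))
      = cinner (blinfun_apply ?T g) h" for g h
    unfolding complex_integral_def Re_cinner Im_cinner signed_integral_eq_inner
    by (rule complex_eqI) (simp_all add: Re_cinner Im_cinner)
  show "?T \<in> bounded_operators \<and> (\<forall>g h. cinner (blinfun_apply ?T g) h =
      complex_integral (borel_on X) (\<lambda>A. cinner (blinfun_apply (F A) g) h) (\<lambda>x. complex_of_real (\<phi> x)))"
    by (simp only: T bounded_operators_add bounded_operators_scaleR bounded_operators_id
        digit_operator_bounded_operators simp_thms)
  fix S assume "S \<in> bounded_operators \<and> (\<forall>g h. cinner (blinfun_apply S g) h =
      complex_integral (borel_on X) (\<lambda>A. cinner (blinfun_apply (F A) g) h) (\<lambda>x. complex_of_real (\<phi> x)))"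
  then show "S = ?T"
    unfolding T by (intro blinfun_eq_innerI) (metis Re_cinner)
qed

end

end


section \<open>The metric\<close>

lemma Lip1_measurable:
  assumes "\<phi> \<in> Lip1 X"
  shows "\<phi> \<in> borel_measurable (borel_on X)"
proof -
  have "1-lipschitz_on X \<phi>"
    using assms by (intro lipschitz_onI) (auto simp: Lip1_def dist_real_def)
  then show ?thesis
    by (intro borel_measurable_continuous_on_restrict lipschitz_on_continuous_on)
qed

text \<open>The constant parts cancel, leaving \<open>2 * (D + 1)\<close> times a difference of two
  operators of norm at most 1. The resulting bound is uniform in \<phi>.\<close>

lemma norm_pvm_integral_diff_le:
  assumes E: "E \<in> PVM X" and F: "F \<in> PVM X"
    and D: "\<And>x y. x \<in> X \<Longrightarrow> y \<in> X \<Longrightarrow> dist x y \<le> D" "0 \<le> D" and \<phi>: "\<phi> \<in> Lip1 X"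
  shows "norm (pvm_integral X E (\<lambda>x. complex_of_real (\<phi> x)) -
    pvm_integral X F (\<lambda>x. complex_of_real (\<phi> x))) \<le> 4 * (D + 1)"
proof -
  obtain c where c: "\<bar>\<phi> x - c\<bar> \<le> D" if "x \<in> X" for x
  proof (cases "X = {}")
    case False
    then obtain x0 where "x0 \<in> X"
      by auto
    then have "\<bar>\<phi> x - \<phi> x0\<bar> \<le> D" if "x \<in> X" for x
      using that \<phi> D(1)[of x x0] by (fastforce simp: Lip1_def)
    then show ?thesis
      using that by blast
  qed auto
  \<comment> \<open>On X the numerator lies between 1 and \<open>2 * D + 1\<close>. The extra 1
    keeps the quotient strictly below 1 and the denominator positive when D is 0.\<close>
  define \<psi> where "\<psi> = (\<lambda>x. (\<phi> x - c + (D + 1)) / (2 * (D + 1)))"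
  note [measurable] = Lip1_measurable[OF \<phi>]
  have \<psi>: "\<psi> \<in> borel_measurable (borel_on X)"
    unfolding \<psi>_def by measurable
  have range: "0 \<le> \<psi> x \<and> \<psi> x < 1" if "x \<in> X" for x
    using c[OF that] D(2) by (simp add: \<psi>_def abs_le_iff)
  have eq: "\<phi> x = (c - (D + 1)) + (2 * (D + 1)) * \<psi> x" for x
    using D(2) by (simp add: \<psi>_def)
  have "pvm_integral X H (\<lambda>x. complex_of_real (\<phi> x)) =
      (c - (D + 1)) *\<^sub>R id_blinfun + (2 * (D + 1)) *\<^sub>R digit_operator X H \<psi>"
    if "H \<in> PVM X" for H :: "'a set \<Rightarrow> 'b \<Rightarrow>\<^sub>L 'b"
    using range eq by (intro pvm_integral_eq[OF that \<psi>])
  then have "pvm_integral X E (\<lambda>x. complex_of_real (\<phi> x)) - pvm_integral X F (\<lambda>x. complex_of_real (\<phi> x)) =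
      (2 * (D + 1)) *\<^sub>R (digit_operator X E \<psi> - digit_operator X F \<psi>)"
    using E F by (simp only: scaleR_diff_right add_diff_cancel_left)
  moreover have "norm (digit_operator X E \<psi> - digit_operator X F \<psi>) \<le> 2"
    using norm_triangle_ineq4[of "digit_operator X E \<psi>" "digit_operator X F \<psi>"]
      norm_digit_operator_le[OF E \<psi>] norm_digit_operator_le[OF F \<psi>] by linarith
  ultimately show ?thesis
    using D(2) mult_left_mono[of "norm (digit_operator X E \<psi> - digit_operator X F \<psi>)" 2 "2 * (D + 1)"]
    by simp
qed

section \<open>Recovering a projection-valued measure from its Lipschitz integrals\<close>

text \<open>On C every term is 1. Off the closed set C the distance is positive, so the terms are
  eventually 0. By convention \<open>infdist x {} = 0\<close>, hence the condition that C is
  nonempty.\<close>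

lemma scaled_tent_tendsto_indicator:
  fixes C :: "'a::metric_space set"
  assumes "closed C" "C \<noteq> {}"
  shows "(\<lambda>n. real (Suc n) * max 0 (1 / real (Suc n) - infdist x C)) \<longlonglongrightarrow> indicator C x"
proof (cases "x \<in> C")
  case True
  then show ?thesis
    by (simp add: max_def)
next
  case False
  then have "0 < infdist x C"
    using assms by (metis in_closed_iff_infdist_zero infdist_nonneg less_le)
  then obtain N where N: "1 / real (Suc N) < infdist x C"
    by (rule nat_approx_posE)
  have "real (Suc n) * max 0 (1 / real (Suc n) - infdist x C) = 0" if "N \<le> n" for n
  proof -
    have "1 / real (Suc n) \<le> 1 / real (Suc N)"
      using that by (simp add: frac_le)
    with N have "1 / real (Suc n) - infdist x C \<le> 0"
      by linarith
    then show ?thesis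
      by (simp only: max.absorb1 mult_zero_right)
  qed
  then show ?thesis
    using False by (intro tendsto_eventually) (auto simp: eventually_sequentially)
qed

text \<open>The tents are 1-Lipschitz, but the multiples that converge to the indicator need not be.
  Equality of integrals reaches the multiples through the digit operators, which both share.\<close>

lemma PVM_eq_on_closed:
  assumes E: "E \<in> PVM X" and F: "F \<in> PVM X"
    and eq: "\<And>\<phi>. \<phi> \<in> Lip1 X \<Longrightarrow>
      pvm_integral X E (\<lambda>x. complex_of_real (\<phi> x)) = pvm_integral X F (\<lambda>x. complex_of_real (\<phi> x))"
    and C: "closed C"
  shows "E (X \<inter> C) = F (X \<inter> C)"
proof (cases "C = {}")
  case True
  then show ?thesis
    using E F by (simp add: PVM_def)
next
  case False
  define tent where "tent = (\<lambda>n x. max 0 (1 / real (Suc n) - infdist x C))"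
  define \<phi> where "\<phi> = (\<lambda>n x. real (Suc n) * tent n x)"
  have Lip: "tent n \<in> Lip1 X" for n
    unfolding Lip1_def
  proof (clarify)
    fix x y
    show "\<bar>tent n x - tent n y\<bar> \<le> dist x y"
      using infdist_triangle_abs[of x C y] unfolding tent_def by linarith
  qed
  have meas: "(\<lambda>x. tent n x / 2) \<in> borel_measurable (borel_on X)" for n
    using Lip1_measurable[OF Lip[of n]] by measurable
  have tent_le: "0 \<le> tent n x" "tent n x \<le> 1 / real (Suc n)" for n x
    using infdist_nonneg[of x C] by (auto simp: tent_def)
  \<comment> \<open>Halving secures the strict upper bound, since \<open>tent 0\<close> equals 1 on
    C.\<close>
  have range: "0 \<le> tent n x / 2 \<and> tent n x / 2 < 1" for n x
  proof -
    have "1 / real (Suc n) \<le> 1"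
      by simp
    then show ?thesis
      using tent_le[where n = n and x = x] by linarith
  qed
  have \<phi>_bound: "\<bar>\<phi> n x\<bar> \<le> 1" for n x
    using mult_left_mono[OF tent_le(2), of "real (Suc n)" n x] tent_le(1)[of n x]
    by (simp add: \<phi>_def abs_mult)
  have tent_eq: "tent n x = 0 + 2 * (tent n x / 2)" for n x
    by simp
  have \<phi>_eq: "\<phi> n x = 0 + (2 * real (Suc n)) * (tent n x / 2)" for n x
    by (simp add: \<phi>_def)
  \<comment> \<open>With a = 0 and b = 2 the integral of the tent is twice the digit operator, so
    equal integrals force equal digit operators.\<close>
  have digit: "digit_operator X E (\<lambda>x. tent n x / 2) = digit_operator X F (\<lambda>x. tent n x / 2)" for n
    using eq[OF Lip[of n]] pvm_integral_eq[OF E meas range tent_eq, of n]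
      pvm_integral_eq[OF F meas range tent_eq, of n]
    by simp
  have sets: "X \<inter> C \<in> sets (borel_on X)"
    using C by (auto simp: sets_restrict_space)
  have \<phi>_meas: "\<phi> n \<in> borel_measurable (borel_on X)" for n
    using Lip1_measurable[OF Lip[of n]] unfolding \<phi>_def by measurable
  have lim: "(\<lambda>n. \<phi> n x) \<longlonglongrightarrow> indicator (X \<inter> C) x" if "x \<in> space (borel_on X)" for x
    using scaled_tent_tendsto_indicator[OF C False, of x] that
    by (simp add: \<phi>_def tent_def space_borel_on indicator_def)
  show ?thesis
  proof (rule blinfun_eq_innerI)
    fix g h
    have "(\<lambda>n. signed_integral (borel_on X) (\<lambda>A. inner (blinfun_apply (H A) g) h)
        (\<lambda>x. complex_of_real (\<phi> n x))) \<longlonglongrightarrow> complex_of_real (inner (blinfun_apply (H (X \<inter> C)) g) h)"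
      if "H \<in> PVM X" for H :: "'a set \<Rightarrow> 'b \<Rightarrow>\<^sub>L 'b"
      by (rule bounded_signed_measure.signed_integral_tendsto_indicator
          [OF PVM_bounded_signed_measure[OF that] \<phi>_meas sets \<phi>_bound lim])
    from this[OF E] this[OF F]
    have "complex_of_real (inner (blinfun_apply (E (X \<inter> C)) g) h) = complex_of_real (inner (blinfun_apply (F (X \<inter> C)) g) h)"
      unfolding signed_integral_eq_inner[OF E meas range \<phi>_eq] signed_integral_eq_inner[OF F meas range \<phi>_eq] digit
      by (rule LIMSEQ_unique)
    then show "inner (blinfun_apply (E (X \<inter> C)) g) h = inner (blinfun_apply (F (X \<inter> C)) g) h"
      by (simp only: of_real_eq_iff)
  qed
qed

text \<open>Dynkin's argument with the closed sets as intersection-stable generator. The induction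
  runs over Borel sets B of the whole space, and the measures are compared on
  \<open>X \<inter> B\<close>.\<close>

lemma PVM_eqI:
  assumes E: "E \<in> PVM X" and F: "F \<in> PVM X"
    and eq: "\<And>\<phi>. \<phi> \<in> Lip1 X \<Longrightarrow>
      pvm_integral X E (\<lambda>x. complex_of_real (\<phi> x)) = pvm_integral X F (\<lambda>x. complex_of_real (\<phi> x))"
  shows "E = F"
proof -
  have on_Int: "E (X \<inter> B) = F (X \<inter> B)" if "B \<in> sets borel" for B
  proof -
    have "Int_stable (Collect closed :: 'a set set)"
      by (auto simp: Int_stable_def)
    moreover have "Collect closed \<subseteq> Pow (UNIV :: 'a set)"
      by simp
    moreover have borel: "sets borel = sigma_sets UNIV (Collect closed :: 'a set set)"
      by (simp add: borel_eq_closed)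
    then have "B \<in> sigma_sets UNIV (Collect closed)"
      using that by simp
    ultimately show ?thesis
    proof (induction B rule: sigma_sets_induct_disjoint)
      case (basic A)
      then show ?case
        using PVM_eq_on_closed[OF E F eq] by simp
    next
      case empty
      then show ?case
        using E F by (simp add: PVM_def)
    next
      case (compl A)
      have sets: "X \<in> sets (borel_on X)" "X \<inter> A \<in> sets (borel_on X)"
        using compl(1) borel by (auto simp: sets_restrict_space intro: image_eqI[of _ _ UNIV])
      \<comment> \<open>Subtractivity is taken from the scalar measures and lifted to operators by
        testing against all g and h.\<close>
      have diff: "inner (blinfun_apply (H (X - X \<inter> A)) g) h =
          inner (blinfun_apply (H X) g) h - inner (blinfun_apply (H (X \<inter> A)) g) h"
        if "H \<in> PVM X" for H :: "'a set \<Rightarrow> 'b \<Rightarrow>\<^sub>L 'b" and g h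
        by (rule bounded_signed_measure.Diff[OF PVM_bounded_signed_measure[OF that] sets]) simp
      have "E X = F X"
        using E F by (simp add: PVM_def)
      then have "E (X - X \<inter> A) = F (X - X \<inter> A)"
        by (intro blinfun_eq_innerI) (simp add: diff E F compl(2))
      moreover have "X \<inter> (UNIV - A) = X - X \<inter> A"
        by auto
      ultimately show ?case
        by simp
    next
      case (union A)
      have sets: "range (\<lambda>i. X \<inter> A i) \<subseteq> sets (borel_on X)"
        using union(2) borel by (auto simp: sets_restrict_space)
      have disj: "disjoint_family (\<lambda>i. X \<inter> A i)"
        using union(1) by (auto simp: disjoint_family_on_def)
      have "E (\<Union>i. X \<inter> A i) = F (\<Union>i. X \<inter> A i)"
      proof (rule blinfun_eqI)
        fix g
        show "blinfun_apply (E (\<Union>i. X \<inter> A i)) g = blinfun_apply (F (\<Union>i. X \<inter> A i)) g"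
          using PVM_sums[OF E sets disj, of g] PVM_sums[OF F sets disj, of g]
          unfolding union(3) by (rule sums_unique2)
      qed
      then show ?case
        by (simp only: Int_UN_distrib)
    qed
  qed
  show ?thesis
  \<comment> \<open>Off the Borel subsets of X both functions are \<open>undefined\<close>, so
    agreement on those subsets gives equality.\<close>
  proof (rule PiE_ext)
    show "E \<in> sets (borel_on X) \<rightarrow>\<^sub>E orthogonal_projections" "F \<in> sets (borel_on X) \<rightarrow>\<^sub>E orthogonal_projections"
      using E F by (auto simp: PVM_def)
    show "E A = F A" if "A \<in> sets (borel_on X)" for A
      using that on_Int by (auto simp: sets_restrict_space)
  qed
qed

section \<open>Finiteness and the metric axioms\<close>

lemma pvm_dist_finite:
  assumes "compact X" "E \<in> PVM X" "F \<in> PVM X"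
  shows "pvm_dist X E F < \<infinity>"
proof -
  obtain D where D: "dist x y \<le> D" if "x \<in> X" "y \<in> X" for x y
    using compact_imp_bounded[OF assms(1)] by (auto simp: bounded_two_points)
  \<comment> \<open>If X is empty, D may be negative; \<open>max 0 D\<close> covers this
    case.\<close>
  have "pvm_dist X E F \<le> ennreal (4 * (max 0 D + 1))"
    unfolding pvm_dist_def using D
    by (intro SUP_least ennreal_leI norm_pvm_integral_diff_le[OF assms(2,3)]) (auto simp: le_max_iff_disj)
  then show ?thesis
    by (simp add: le_less_trans)
qed

lemma pvm_dist_commute: "pvm_dist X E F = pvm_dist X F E"
  by (simp add: pvm_dist_def norm_minus_commute)

lemma pvm_dist_self: "pvm_dist X E E = 0"
  by (auto simp: pvm_dist_def Lip1_def intro!: antisym SUP_least)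

lemma pvm_dist_triangle: "pvm_dist X E G \<le> pvm_dist X E F + pvm_dist X F G"
  unfolding pvm_dist_def[of X E G]
proof (rule SUP_least)
  fix \<phi> :: "'a \<Rightarrow> real" assume \<phi>: "\<phi> \<in> Lip1 X"
  let ?I = "\<lambda>H. pvm_integral X H (\<lambda>x. complex_of_real (\<phi> x))"
  have "ennreal (norm (?I E - ?I G)) \<le> ennreal (norm (?I E - ?I F)) + ennreal (norm (?I F - ?I G))"
    using norm_triangle_ineq[of "?I E - ?I F" "?I F - ?I G"]
    by (simp add: ennreal_leI flip: ennreal_plus)
  also have "\<dots> \<le> pvm_dist X E F + pvm_dist X F G"
    unfolding pvm_dist_def using \<phi> by (intro add_mono SUP_upper)
  finally show "ennreal (norm (?I E - ?I G)) \<le> pvm_dist X E F + pvm_dist X F G" .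
qed

lemma pvm_dist_eq_0D:
  assumes "E \<in> PVM X" "F \<in> PVM X" "pvm_dist X E F = 0"
  shows "E = F"
proof (rule PVM_eqI[OF assms(1,2)])
  fix \<phi> :: "'a \<Rightarrow> real" assume "\<phi> \<in> Lip1 X"
  then have "ennreal (norm (pvm_integral X E (\<lambda>x. complex_of_real (\<phi> x)) -
      pvm_integral X F (\<lambda>x. complex_of_real (\<phi> x)))) \<le> 0"
    unfolding assms(3)[symmetric] pvm_dist_def by (rule SUP_upper)
  then show "pvm_integral X E (\<lambda>x. complex_of_real (\<phi> x)) = pvm_integral X F (\<lambda>x. complex_of_real (\<phi> x))"
    by (simp add: ennreal_eq_0_iff)
qed

theorem theorem2p5:
  fixes X :: "'a::metric_space set"
  assumes "compact X"
  shows "(\<forall>E\<in>(PVM X :: ('a set \<Rightarrow> 'h::chilbert_space \<Rightarrow>\<^sub>L 'h) set). \<forall>F\<in>PVM X. pvm_dist X E F < \<infinity>) \<and>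
    Metric_space (PVM X :: ('a set \<Rightarrow> 'h \<Rightarrow>\<^sub>L 'h) set) (\<lambda>E F. enn2real (pvm_dist X E F))"
proof (intro conjI ballI)
  show fin: "pvm_dist X E F < \<infinity>" if "E \<in> PVM X" "F \<in> PVM X" for E F :: "'a set \<Rightarrow> 'h \<Rightarrow>\<^sub>L 'h"
    using pvm_dist_finite[OF assms that] .
  show "Metric_space (PVM X :: ('a set \<Rightarrow> 'h \<Rightarrow>\<^sub>L 'h) set) (\<lambda>E F. enn2real (pvm_dist X E F))"
  proof
    fix E F G :: "'a set \<Rightarrow> 'h \<Rightarrow>\<^sub>L 'h"
    show "0 \<le> enn2real (pvm_dist X E F)"
      by simp
    show "enn2real (pvm_dist X E F) = enn2real (pvm_dist X F E)"
      by (simp only: pvm_dist_commute[of X E F])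
    assume E: "E \<in> PVM X" and F: "F \<in> PVM X"
    \<comment> \<open>\<open>enn2real\<close> also sends \<infinity> to 0, so finiteness is what
      lets a zero value mean a vanishing supremum.\<close>
    show "enn2real (pvm_dist X E F) = 0 \<longleftrightarrow> E = F"
      using fin[OF E F] pvm_dist_eq_0D[OF E F] pvm_dist_self[of X F]
      by (auto simp: enn2real_eq_0_iff)
    assume G: "G \<in> PVM X"
    have "enn2real (pvm_dist X E G) \<le> enn2real (pvm_dist X E F + pvm_dist X F G)"
      using fin[OF E F] fin[OF F G] by (intro enn2real_mono pvm_dist_triangle) auto
    then show "enn2real (pvm_dist X E G) \<le> enn2real (pvm_dist X E F) + enn2real (pvm_dist X F G)"
      using fin[OF E F] fin[OF F G] by (simp add: enn2real_plus)
  qed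
qed

end
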